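(* Let $R(n)$ be the number of reducible profiles of size at most $n$ and $T(n)$ the number of profiles of size at most $n$. Then $\lim_{n\to\infty} R(n)/T(n) = 0$.
   Context: A profile is a sequence $\mathbf{p}=(p_i)_{i\in\mathbb{N}}$ of natural numbers for which there exists $h\ge -1$ with $p_i\ge 1$ for $0\le i\le h$ and $p_i=0$ for $i>h$ (the null sequence $(0)$ is a profile). $\mathbf{P}$ is the set of profiles, with elementwise sum and product $(\mathbf{p}\times\mathbf{q})_i = p_i\sum_{j=0}^i q_j + q_i\sum_{j=0}^i p_j - p_i q_i$. The size of $\mathbf{p}$ is $|\mathbf{p}|=\sum_{i} p_i$. The profile $(1)=(1,0,0,\ldots)$ is the multiplicative identity. A profile $\mathbf{p}$ is reducible if $\mathbf{p}=\mathbf{q}\times\mathbf{r}$ for some profiles $\mathbf{q},\mathbf{r}$ both different from $(1)$, and irreducible otherwise. *)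

theory Defs
  imports Complex_Main
begin

text \<open>Profiles are modelled as functions \<open>nat \<Rightarrow> nat\<close> satisfying a predicate. The height \<open>h\<close> is
  an integer because the null sequence has height \<open>-1\<close>.\<close>

definition is_profile :: "(nat \<Rightarrow> nat) \<Rightarrow> bool" where
  "is_profile p \<longleftrightarrow> (\<exists>h::int. h \<ge> -1 \<and> (\<forall>i. int i \<le> h \<longrightarrow> p i \<ge> 1) \<and> (\<forall>i. int i > h \<longrightarrow> p i = 0))"

text \<open>The subtraction on \<open>nat\<close> never truncates, since \<open>p i * q i \<le> p i * (\<Sum>j\<le>i. q j)\<close>.\<close>

definition profile_mult :: "(nat \<Rightarrow> nat) \<Rightarrow> (nat \<Rightarrow> nat) \<Rightarrow> nat \<Rightarrow> nat" where
  "profile_mult p q = (\<lambda>i. p i * (\<Sum>j\<le>i. q j) + q i * (\<Sum>j\<le>i. p j) - p i * q i)"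

definition profile_one :: "nat \<Rightarrow> nat" where
  "profile_one = (\<lambda>i. if i = 0 then 1 else 0)"

text \<open>The series below is a finite sum for every profile.\<close>

definition profile_size :: "(nat \<Rightarrow> nat) \<Rightarrow> nat" where
  "profile_size p = (\<Sum>i. p i)"

definition reducible_profile :: "(nat \<Rightarrow> nat) \<Rightarrow> bool" where
  "reducible_profile p \<longleftrightarrow> is_profile p \<and>
     (\<exists>q r. is_profile q \<and> is_profile r \<and> q \<noteq> profile_one \<and> r \<noteq> profile_one \<and>
            p = profile_mult q r)"

definition num_profiles :: "nat \<Rightarrow> nat" where
  "num_profiles n = card {p. is_profile p \<and> profile_size p \<le> n}"

definition num_reducible_profiles :: "nat \<Rightarrow> nat" where
  "num_reducible_profiles n = card {p. reducible_profile p \<and> profile_size p \<le> n}"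

text \<open>The counted sets are finite, so the cardinalities are the intended ones.\<close>

lemma finite_profiles_size_le: "finite {p. is_profile p \<and> profile_size p \<le> n}"
proof (rule finite_subset)
  show "finite {p :: nat \<Rightarrow> nat. \<forall>i. (i \<in> {..<n} \<longrightarrow> p i \<in> {..n}) \<and> (i \<notin> {..<n} \<longrightarrow> p i = 0)}"
    by (rule finite_set_of_finite_funs) auto
  show "{p. is_profile p \<and> profile_size p \<le> n} \<subseteq>
        {p. \<forall>i. (i \<in> {..<n} \<longrightarrow> p i \<in> {..n}) \<and> (i \<notin> {..<n} \<longrightarrow> p i = 0)}"
  proof (clarify)
    fix p i assume p: "is_profile p" and le: "profile_size p \<le> n"
    obtain h :: int where h: "h \<ge> -1" "\<And>i. int i \<le> h \<Longrightarrow> p i \<ge> 1" "\<And>i. int i > h \<Longrightarrow> p i = 0"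
      using p by (auto simp: is_profile_def)
    define N where "N = nat (h + 1)"
    have zero: "p i = 0" if "i \<notin> {..<N}" for i
      using that h(1) by (intro h(3)) (auto simp: N_def)
    have sz: "profile_size p = (\<Sum>i<N. p i)"
      unfolding profile_size_def by (rule suminf_finite) (use zero in auto)
    have "N = (\<Sum>i<N. 1)" by simp
    also have "\<dots> \<le> (\<Sum>i<N. p i)"
      by (rule sum_mono) (use h(2) in \<open>auto simp: N_def\<close>)
    finally have N: "N \<le> n" using sz le by simp
    have "p i \<le> n"
    proof (cases "i < N")
      case True
      then have "p i \<le> (\<Sum>i<N. p i)" by (intro member_le_sum) auto
      then show ?thesis using sz le by simp
    qed (use zero in auto)
    then show "(i \<in> {..<n} \<longrightarrow> p i \<in> {..n}) \<and> (i \<notin> {..<n} \<longrightarrow> p i = 0)"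
      using zero[of i] N by auto
  qed
qed

lemma finite_reducible_profiles_size_le:
  "finite {p. reducible_profile p \<and> profile_size p \<le> n}"
  by (rule finite_subset[OF _ finite_profiles_size_le[of n]]) (auto simp: reducible_profile_def)

end

theory Submission
  imports Defs "HOL-Real_Asymp.Real_Asymp"
begin

text \<open>
  Taking partial sums turns the product of profiles into the pointwise product, so the size is
  multiplicative. A nonzero reducible profile of size at most \<open>n\<close> is therefore a product of
  profiles of sizes \<open>a, b \<ge> 2\<close> with \<open>a * b \<le> n\<close>, which forces \<open>a + b \<le> n / 2 + 2\<close>. As there are
  \<open>2 ^ n\<close> profiles of size at most \<open>n\<close>, only \<open>O(n * 2 ^ (n / 2))\<close> of them are reducible.
\<close>

section \<open>Structure and size of profiles\<close>

text \<open>The integer height \<open>h\<close> is traded for the support length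
  \<open>N = h + 1\<close>, a natural number; the null profile becomes the case
  \<open>N = 0\<close>.\<close>

lemma is_profile_iff: "is_profile p \<longleftrightarrow> (\<exists>N. \<forall>i. 0 < p i \<longleftrightarrow> i < N)"
proof
  assume "is_profile p"
  then obtain h :: int where h: "h \<ge> -1" "\<And>i. int i \<le> h \<Longrightarrow> p i \<ge> 1" "\<And>i. int i > h \<Longrightarrow> p i = 0"
    by (auto simp: is_profile_def)
  have "0 < p i \<longleftrightarrow> i < nat (h + 1)" for i
    using h(1) h(2)[of i] h(3)[of i] by (cases "int i \<le> h") auto
  then show "\<exists>N. \<forall>i. 0 < p i \<longleftrightarrow> i < N" by blast
next
  assume "\<exists>N. \<forall>i. 0 < p i \<longleftrightarrow> i < N"
  then obtain N where N: "\<And>i. 0 < p i \<longleftrightarrow> i < N" by blast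
  have "p i \<ge> 1" if "int i \<le> int N - 1" for i
    using N[of i] that by simp
  moreover have "p i = 0" if "int i > int N - 1" for i
    using N[of i] that by simp
  ultimately show "is_profile p"
    unfolding is_profile_def by (intro exI[of _ "int N - 1"]) auto
qed

lemma is_profile_zero: "is_profile (\<lambda>_. 0)"
  by (auto simp: is_profile_iff)

lemma is_profile_eq_zero: "is_profile p \<Longrightarrow> p 0 = 0 \<Longrightarrow> p = (\<lambda>_. 0)"
  by (metis is_profile_iff gr_zeroI less_nat_zero_code not_gr_zero)

text \<open>\<open>case_nat a p\<close> puts the entry \<open>a\<close> in front of
  \<open>p\<close>, so that profiles can be handled like finite lists of positive numbers, with the
  null profile as empty list.\<close>

lemma is_profile_case_nat:
  assumes "0 < a"
  shows "is_profile (case_nat a p) \<longleftrightarrow> is_profile p"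
proof
  assume "is_profile p"
  then obtain N where "\<And>i. 0 < p i \<longleftrightarrow> i < N" by (auto simp: is_profile_iff)
  then have "\<forall>i. 0 < case_nat a p i \<longleftrightarrow> i < Suc N"
    using assms by (auto split: nat.split)
  then show "is_profile (case_nat a p)" by (auto simp: is_profile_iff)
next
  assume "is_profile (case_nat a p)"
  then obtain N where N: "\<And>i. 0 < case_nat a p i \<longleftrightarrow> i < N" by (auto simp: is_profile_iff)
  have "0 < p i \<longleftrightarrow> i < N - 1" for i
    using N[of "Suc i"] by auto
  then show "is_profile p" by (auto simp: is_profile_iff)
qed

lemma profile_size_eq_sum:
  assumes "\<And>i. N < i \<Longrightarrow> p i = 0"
  shows "profile_size p = (\<Sum>i\<le>N. p i)"
  unfolding profile_size_def by (rule suminf_finite) (use assms in auto)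

lemma profile_support_bound:
  assumes "is_profile p"
  obtains N where "\<And>i. N < i \<Longrightarrow> p i = 0"
  using assms unfolding is_profile_iff by (meson gr_zeroI less_trans less_irrefl)

lemma profile_size_zero [simp]: "profile_size (\<lambda>_. 0) = 0"
  by (simp add: profile_size_def)

lemma profile_size_case_nat:
  assumes "is_profile p"
  shows "profile_size (case_nat a p) = a + profile_size p"
proof -
  obtain N where N: "\<And>i. N < i \<Longrightarrow> p i = 0" using profile_support_bound[OF assms] by blast
  then have "profile_size (case_nat a p) = (\<Sum>i\<le>Suc N. case_nat a p i)"
    by (intro profile_size_eq_sum) (auto split: nat.split)
  also have "\<dots> = a + (\<Sum>i\<le>N. p i)"
    by (simp add: sum.atMost_Suc_shift del: sum.atMost_Suc)
  finally show ?thesis using profile_size_eq_sum[of N p] N by simp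
qed

lemma profile_cases:
  assumes "is_profile p"
  obtains "p = (\<lambda>_. 0)" | a q where "0 < a" "is_profile q" "p = case_nat a q"
proof (cases "p 0 = 0")
  case True
  then show ?thesis using that(1) is_profile_eq_zero[OF assms] by blast
next
  case False
  have p: "p = case_nat (p 0) (\<lambda>i. p (Suc i))"
    by (rule ext) (simp split: nat.split)
  with assms False have "is_profile (\<lambda>i. p (Suc i))"
    using is_profile_case_nat[of "p 0" "\<lambda>i. p (Suc i)"] by simp
  then show ?thesis using that(2) p False by blast
qed

text \<open>A nonnull profile has a positive first entry; if its size were 1, this entry would be 1
  and nothing could follow it.\<close>

lemma profile_size_ge_2:
  assumes "is_profile p" "p \<noteq> (\<lambda>_. 0)" "p \<noteq> profile_one"
  shows "2 \<le> profile_size p"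
  using assms(1)
proof (cases rule: profile_cases)
  case (2 a q)
  have "p = profile_one" if "a = 1" "q = (\<lambda>_. 0)"
    using that 2 by (auto simp: profile_one_def fun_eq_iff split: nat.split)
  moreover have "0 < profile_size q" if "q \<noteq> (\<lambda>_. 0)"
    using \<open>is_profile q\<close> that
    by (cases rule: profile_cases) (auto simp: profile_size_case_nat)
  ultimately show ?thesis
    using 2 assms(3)
    by (cases "a = 1"; cases "q = (\<lambda>_. 0)") (simp_all add: profile_size_case_nat Suc_le_eq)
qed (use assms in simp)

section \<open>Multiplicativity of the size\<close>

text \<open>With partial sums \<open>P k\<close> and \<open>Q k\<close>, entry \<open>k\<close> of
  the product is \<open>P k * Q k - (P k - p k) * (Q k - q k)\<close>, so the sum
  telescopes.\<close>

lemma sum_profile_mult: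
  "(\<Sum>i\<le>k. profile_mult p q i) = (\<Sum>i\<le>k. p i) * (\<Sum>i\<le>k. q i)"
  by (induction k) (simp_all add: profile_mult_def algebra_simps)

lemma profile_size_mult:
  assumes "is_profile p" "is_profile q"
  shows "profile_size (profile_mult p q) = profile_size p * profile_size q"
proof -
  obtain M N where M: "\<And>i. M < i \<Longrightarrow> p i = 0" and N: "\<And>i. N < i \<Longrightarrow> q i = 0"
    using assms by (metis profile_support_bound)
  \<comment> \<open>Beyond \<open>K\<close> both factors vanish, hence so does the product, and all
    three sizes are partial sums up to the same index.\<close>
  define K where "K = max M N"
  have "profile_size p = (\<Sum>i\<le>K. p i)" "profile_size q = (\<Sum>i\<le>K. q i)"
    "profile_size (profile_mult p q) = (\<Sum>i\<le>K. profile_mult p q i)"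
    using M N by (auto simp: K_def profile_mult_def intro!: profile_size_eq_sum)
  then show ?thesis by (simp add: sum_profile_mult)
qed

section \<open>Counting all profiles\<close>

text \<open>The count doubles at each step. A nonnull profile of size at most \<open>n + 1\<close>
  either starts with 1, which can be deleted, or with an entry at least 2, which can be decremented
  to leave a nonnull profile.\<close>

lemma num_profiles_eq: "num_profiles n = 2 ^ n"
proof -
  define S where "S n = {p. is_profile p \<and> profile_size p \<le> n}" for n
  \<comment> \<open>The inverse of decrementing. It is applied to nonnull profiles only: on the null
    one it would give the profile (1), which already arises by prepending 1.\<close>
  define inc :: "(nat \<Rightarrow> nat) \<Rightarrow> nat \<Rightarrow> nat" where "inc p = case_nat (Suc (p 0)) (\<lambda>i. p (Suc i))" for p
  have fin: "finite (S n)" for n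
    unfolding S_def by (rule finite_profiles_size_le)
  have zero_in: "(\<lambda>_. 0) \<in> S n" for n
    by (simp add: S_def is_profile_zero)
  have S_Suc: "S (Suc n) = insert (\<lambda>_. 0) (case_nat 1 ` S n \<union> inc ` (S n - {\<lambda>_. 0}))" for n
  proof (intro equalityI subsetI)
    fix p assume "p \<in> S (Suc n)"
    then have p: "is_profile p" "profile_size p \<le> Suc n" by (auto simp: S_def)
    from p(1) show "p \<in> insert (\<lambda>_. 0) (case_nat 1 ` S n \<union> inc ` (S n - {\<lambda>_. 0}))"
    proof (cases rule: profile_cases)
      case (2 a q)
      show ?thesis
      proof (cases "a = 1")
        case True
        then show ?thesis using 2 p(2) by (auto simp: S_def profile_size_case_nat)
      next
        case False
        have "p = inc (case_nat (a - 1) q)"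
          using 2 by (simp add: inc_def)
        moreover have "case_nat (a - 1) q \<in> S n"
          using 2 False p(2) by (auto simp: S_def profile_size_case_nat is_profile_case_nat)
        moreover have "case_nat (a - 1) q 0 \<noteq> 0"
          using 2 False by simp
        then have "case_nat (a - 1) q \<noteq> (\<lambda>_. 0)" by (metis (full_types))
        ultimately show ?thesis by blast
      qed
    qed simp
  next
    fix p assume "p \<in> insert (\<lambda>_. 0) (case_nat 1 ` S n \<union> inc ` (S n - {\<lambda>_. 0}))"
    then consider "p = (\<lambda>_. 0)" | q where "q \<in> S n" "p = case_nat 1 q"
      | q where "q \<in> S n" "q \<noteq> (\<lambda>_. 0)" "p = inc q" by blast
    then show "p \<in> S (Suc n)"
    proof cases
      case 1
      then show ?thesis by (simp add: zero_in)
    next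
      case 2
      then show ?thesis by (simp add: S_def profile_size_case_nat is_profile_case_nat)
    next
      case 3
      have "is_profile q" using 3(1) by (simp add: S_def)
      then show ?thesis
      proof (cases rule: profile_cases)
        case (2 a r)
        then show ?thesis
          using 3 by (simp add: S_def inc_def profile_size_case_nat is_profile_case_nat)
      qed (use 3 in simp)
    qed
  qed
  have inj_cons: "inj_on (case_nat (Suc 0)) A" for A :: "(nat \<Rightarrow> nat) set"
    by (rule inj_onI) (metis nat.case(2) ext)
  have inj_inc: "inj_on inc A" for A
  proof (rule inj_onI, rule ext)
    fix p q :: "nat \<Rightarrow> nat" and i :: nat assume "inc p = inc q"
    then have "inc p i = inc q i" by simp
    then show "p i = q i" by (cases i) (simp_all add: inc_def)
  qed
  \<comment> \<open>The first entry is 1 on the left and at least 2 on the right.\<close>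
  have disj: "case_nat 1 ` S n \<inter> inc ` (S n - {\<lambda>_. 0}) = {}" for n
  proof -
    have False if "q \<in> S n" "q \<noteq> (\<lambda>_. 0)" "case_nat 1 p = inc q" for p q
    proof -
      have "q 0 \<noteq> 0" using that is_profile_eq_zero by (auto simp: S_def)
      then show False using fun_cong[OF that(3), of 0] by (simp add: inc_def)
    qed
    then show ?thesis by blast
  qed
  have notin: "(\<lambda>_. 0) \<notin> case_nat 1 ` S n \<union> inc ` (S n - {\<lambda>_. 0})" for n
  proof
    assume "(\<lambda>_. 0) \<in> case_nat 1 ` S n \<union> inc ` (S n - {\<lambda>_. 0})"
    then obtain q :: "nat \<Rightarrow> nat" where "(\<lambda>_. 0) = case_nat 1 q \<or> (\<lambda>_. 0) = inc q" by blast
    then show False by (auto simp: inc_def dest: fun_cong[of _ _ 0])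
  qed
  have "card (S n) = 2 ^ n"
  proof (induction n)
    case 0
    have "S 0 = {\<lambda>_. 0}"
    proof (intro equalityI subsetI)
      fix p assume "p \<in> S 0"
      then have "is_profile p" "profile_size p = 0" by (auto simp: S_def)
      then show "p \<in> {\<lambda>_. 0}"
        by (cases rule: profile_cases) (auto simp: profile_size_case_nat)
    qed (use zero_in in auto)
    then show ?case by simp
  next
    case (Suc n)
    have "card (S (Suc n)) = Suc (card (S n) + card (S n - {\<lambda>_. 0}))"
      using fin[of n] notin[of n] disj[of n]
      by (simp add: S_Suc card_Un_disjoint card_image inj_cons inj_inc)
    \<comment> \<open>The null profile counted by \<open>Suc\<close> makes up for the one removed
      from \<open>S n\<close>.\<close>
    also have "\<dots> = 2 * card (S n)"
      using fin[of n] zero_in[of n] card_gt_0_iff[of "S n"] by auto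
    finally show ?case using Suc by simp
  qed
  then show ?thesis by (simp add: num_profiles_def S_def)
qed

section \<open>Bounding the reducible profiles\<close>

text \<open>Expanding \<open>(a - 2) * (b - 2) \<ge> 0\<close> gives
  \<open>2 * (a + b - 2) \<le> a * b\<close>.\<close>

lemma add_le_of_mult_le:
  fixes a b n :: nat
  assumes "2 \<le> a" "2 \<le> b" "a * b \<le> n"
  shows "a + b \<le> n div 2 + 2"
proof -
  obtain c d where "a = c + 2" "b = d + 2"
    using assms(1,2) by (metis add.commute le_Suc_ex)
  with assms(3) have "2 * (a + b - 2) \<le> n" by (simp add: algebra_simps)
  then show ?thesis by linarith
qed

lemma num_reducible_profiles_le:
  "num_reducible_profiles n \<le> 1 + (n + 3) * 2 ^ (n div 2 + 2)"
proof -
  define S where "S n = {p. is_profile p \<and> profile_size p \<le> n}" for n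
  define m where "m = n div 2 + 2"
  \<comment> \<open>Bounding the second factor by \<open>m - a\<close> makes the exponents of the
    two counts add up to \<open>m\<close> for every \<open>a \<le> m\<close>.\<close>
  define F where "F a = (\<lambda>(q, r). profile_mult q r) ` (S a \<times> S (m - a))" for a
  have fin: "finite (S n)" for n
    unfolding S_def by (rule finite_profiles_size_le)
  have card_S: "card (S n) = 2 ^ n" for n
    using num_profiles_eq[of n] by (simp add: num_profiles_def S_def)
  have card_F: "card (F a) \<le> 2 ^ m" if "a \<le> m" for a
  proof -
    have "card (F a) \<le> card (S a \<times> S (m - a))"
      unfolding F_def by (rule card_image_le) (simp add: fin)
    also have "\<dots> = 2 ^ m"
      using that by (simp add: card_cartesian_product card_S flip: power_add)
    finally show ?thesis .
  qed
  have sub: "{p. reducible_profile p \<and> profile_size p \<le> n} \<subseteq> insert (\<lambda>_. 0) (\<Union>a\<le>m. F a)"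
  proof clarify
    fix p assume p: "reducible_profile p" "profile_size p \<le> n" "p \<notin> (\<Union>a\<le>m. F a)"
    then obtain q r where qr: "is_profile q" "is_profile r" "q \<noteq> profile_one" "r \<noteq> profile_one"
      and p_eq: "p = profile_mult q r"
      by (auto simp: reducible_profile_def)
    \<comment> \<open>A null factor puts no bound on the size of the other one, so the null product
      is counted separately.\<close>
    have "q = (\<lambda>_. 0) \<or> r = (\<lambda>_. 0)"
    proof (rule ccontr)
      assume "\<not> (q = (\<lambda>_. 0) \<or> r = (\<lambda>_. 0))"
      then have "profile_size q + profile_size r \<le> m"
        unfolding m_def using p(2) qr
        by (intro add_le_of_mult_le) (auto intro: profile_size_ge_2 simp: p_eq profile_size_mult)
      then have "p \<in> F (profile_size q)" "profile_size q \<le> m"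
        using qr by (auto simp: F_def S_def p_eq)
      with p(3) show False by blast
    qed
    then show "p = (\<lambda>_. 0)" by (auto simp: p_eq profile_mult_def)
  qed
  have "num_reducible_profiles n \<le> card (insert (\<lambda>_. 0) (\<Union>a\<le>m. F a))"
    unfolding num_reducible_profiles_def by (rule card_mono[OF _ sub]) (simp add: F_def fin)
  also have "\<dots> \<le> 1 + card (\<Union>a\<le>m. F a)"
    using card_insert_le_m1 by (simp add: card_insert_if F_def fin)
  also have "card (\<Union>a\<le>m. F a) \<le> (\<Sum>a\<le>m. card (F a))"
    by (rule card_UN_le) simp
  also have "\<dots> \<le> (\<Sum>a\<le>m. 2 ^ m)"
    by (rule sum_mono) (simp add: card_F)
  also have "\<dots> = (m + 1) * 2 ^ m"
    by simp
  \<comment> \<open>Here \<open>m + 1 = n div 2 + 3\<close>.\<close>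
  also have "\<dots> \<le> (n + 3) * 2 ^ m"
    by (intro mult_right_mono) (auto simp: m_def)
  finally show ?thesis by (simp add: m_def)
qed

section \<open>Passage to the limit\<close>

theorem theorem5:
  "(\<lambda>n. real (num_reducible_profiles n) / real (num_profiles n)) \<longlonglongrightarrow> 0"
proof (rule tendsto_sandwich[OF _ _ tendsto_const])
  \<comment> \<open>The majorant uses \<open>real n / 2\<close> in place of \<open>n div 2\<close>,
    which leaves an elementary real function of order \<open>n * 2 powr (- n / 2)\<close>.\<close>
  show "(\<lambda>n. (1 + (real n + 3) * 2 powr (real n / 2 + 2)) / 2 powr real n) \<longlonglongrightarrow> 0"
    by real_asymp
  show "\<forall>\<^sub>F n in sequentially. real (num_reducible_profiles n) / real (num_profiles n)
      \<le> (1 + (real n + 3) * 2 powr (real n / 2 + 2)) / 2 powr real n"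
  proof (rule always_eventually, rule allI)
    fix n
    have "real (2 * (n div 2)) \<le> real n"
      by (rule of_nat_mono) simp
    then have half: "real (n div 2 + 2) \<le> real n / 2 + 2"
      by simp
    have "real (num_reducible_profiles n) \<le> real (1 + (n + 3) * 2 ^ (n div 2 + 2))"
      using num_reducible_profiles_le by (rule of_nat_mono)
    also have "\<dots> = 1 + (real n + 3) * 2 powr real (n div 2 + 2)"
      by (subst powr_realpow) simp_all
    also have "\<dots> \<le> 1 + (real n + 3) * 2 powr (real n / 2 + 2)"
      using half by (intro add_left_mono mult_left_mono powr_mono) auto
    finally show "real (num_reducible_profiles n) / real (num_profiles n)
      \<le> (1 + (real n + 3) * 2 powr (real n / 2 + 2)) / 2 powr real n"
      by (simp add: num_profiles_eq powr_realpow divide_right_mono)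
  qed
qed simp

end
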